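(* Let $x$ be a complex number and $n\ge 2$ an integer such that all quantities below are defined. Then \[ \sum_{k=0}^n\binom{2n-k}{n}\binom{x+k}{k}k^2H^2_{k}(x)=\frac{(x+1)(xn+3n+1)}{8(n-1)}\binom{x+2n+1}{n-2}\Big\{8\big[H_{n+3}(x)-H_{2n+1}(x)\big] \big[H_{n+3}(x)-H_{2n+1}(x)-\tfrac{2(2xn+4n+1)}{(x+1)(xn+3n+1)}\big] -\big[H_n(\tfrac{x}{2})-H_{n+1}(\tfrac{x-1}{2})\big] \big[H_n(\tfrac{x}{2})-H_{n+1}(\tfrac{x-1}{2})-\tfrac{4(x+n+1)(x^2+3x-2n+1)}{n(x+1)(xn+3n+1)}\big] +8H_{n+3}^{\langle2\rangle}(x)-4H_{2n+1}^{\langle2\rangle}(x)+\tfrac{8(x^2+3x+3n^2-n+1)}{n(x+1)(xn+3n+1)}\Big\}. \]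
   Context: For a complex $y$ and an integer $k\ge 0$, $\binom{y}{k}=\frac{y(y-1)\cdots(y-k+1)}{k!}$. For complex $x$, integer $n\ge 0$ and positive integer $\ell$: $H_0^{\langle\ell\rangle}(x)=0$, $H_n^{\langle\ell\rangle}(x)=\sum_{k=1}^n\frac{1}{(x+k)^\ell}$, and $H_n(x)=H_n^{\langle1\rangle}(x)$; $H_n^2(x)$ denotes $(H_n(x))^2$. *)

theory Defs
  imports Complex_Main
begin

definition gen_harm :: "nat \<Rightarrow> nat \<Rightarrow> complex \<Rightarrow> complex"
  where "gen_harm l n x = (\<Sum>k=1..n. 1 / (x + of_nat k) ^ l)"

abbreviation harm1 :: "nat \<Rightarrow> complex \<Rightarrow> complex"
  where "harm1 n x \<equiv> gen_harm 1 n x"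

text \<open>
  The quantities \<open>H\<^sub>n\<^sub>+\<^sub>3(x)\<close>, \<open>H\<^sub>2\<^sub>n\<^sub>+\<^sub>1(x)\<close>, \<open>H\<^sub>n(x/2)\<close>, \<open>H\<^sub>n\<^sub>+\<^sub>1((x-1)/2)\<close> and the fractions with denominator
  \<open>(x+1)(xn+3n+1)\<close> are all defined iff \<open>x\<close> avoids \<open>-1, ..., -(2n+1)\<close> and \<open>xn + 3n + 1 \<noteq> 0\<close>;
  the theorem assumes the latter, shorter form.
\<close>

lemma all_denominators_nonzero_iff:
  fixes x :: complex and n :: nat
  assumes "n \<ge> 2"
  shows "((\<forall>k\<in>{1..n+3}. x + of_nat k \<noteq> 0) \<and> (\<forall>k\<in>{1..2*n+1}. x + of_nat k \<noteq> 0) \<and>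
          (\<forall>k\<in>{1..n}. x/2 + of_nat k \<noteq> 0) \<and> (\<forall>k\<in>{1..n+1}. (x-1)/2 + of_nat k \<noteq> 0) \<and>
          (x + 1) * (x * of_nat n + 3 * of_nat n + 1) \<noteq> 0) \<longleftrightarrow>
         (\<forall>k\<in>{1..2*n+1}. x + of_nat k \<noteq> 0) \<and> x * of_nat n + 3 * of_nat n + 1 \<noteq> 0"
    (is "?L \<longleftrightarrow> ?R")
proof
  assume ?L
  then show ?R by auto
next
  assume R: ?R
  have nz: "x + of_nat k \<noteq> 0" if "1 \<le> k" "k \<le> 2*n+1" for k
    using R that by auto
  have 1: "x/2 + of_nat k \<noteq> 0" if "k \<in> {1..n}" for k
    using nz[of "2*k"] that by (auto simp: field_simps)
  have 2: "(x-1)/2 + of_nat k \<noteq> 0" if "k \<in> {1..n+1}" for k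
  proof -
    have "of_nat (2*k-1) = 2 * of_nat k - (1::complex)"
      using that by (simp add: of_nat_diff)
    moreover have "1 \<le> 2*k-1" "2*k-1 \<le> 2*n+1" using that by auto
    ultimately have "x + (2 * of_nat k - 1) \<noteq> 0" using nz[of "2*k-1"] by simp
    then show ?thesis by (auto simp: field_simps)
  qed
  have 3: "x + 1 \<noteq> 0" using nz[of 1] by simp
  show ?L using 1 2 3 R nz assms by auto
qed

end

theory Submission
  imports Defs
begin

text \<open>
  Write \<open>L\<^sub>n(g)\<close> for the sum of \<open>binom(2n-k, n) g\<^sub>k\<close> over \<open>k \<le> n\<close>, and view \<open>g\<close> as a power series in \<open>z\<close>.
  Then \<open>L\<^sub>n(g)\<close> is the residue of \<open>g / w^(n+1)\<close> with \<open>w = z(1-z)\<close>, so that \<open>L\<^sub>n\<^sub>+\<^sub>1(w g) = L\<^sub>n(g)\<close>,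
  and since total derivatives have no residue, \<open>L\<^sub>n(w g') = n L\<^sub>n((1-2z) g)\<close>.
  If \<open>(1-z) g' = y g + r\<close>, these two rules yield a first-order recurrence in \<open>n\<close> for \<open>L\<^sub>n(g)\<close>
  with an inhomogeneity coming from \<open>r\<close>, and express \<open>L\<^sub>n\<close> of \<open>k g\<^sub>k\<close> and \<open>k\<^sup>2 g\<^sub>k\<close> through \<open>L\<^sub>n(g)\<close>.
  With \<open>a\<^sub>k = binom(x+k, k)\<close> the series of \<open>a\<^sub>k\<close>, \<open>a\<^sub>k H\<^sub>k\<close>, \<open>a\<^sub>k H\<^sub>k\<^sup>2\<close> satisfy such equations with
  \<open>r\<close> equal to \<open>0\<close>, \<open>a\<^sub>k\<close>, \<open>2 a\<^sub>k H\<^sub>k + a\<^sub>k/(x+k+1)\<close>. Divided by \<open>binom(x+2n+1, n)\<close>, the recurrences telescope;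
  the half-argument harmonic numbers enter through \<open>a\<^sub>k/(x+k+1)\<close>, whose sum is an alternating harmonic sum.
\<close>

section \<open>Weighted sums and the two residue rules\<close>

definition bsum :: "nat \<Rightarrow> (nat \<Rightarrow> complex) \<Rightarrow> complex"
  where "bsum n g = (\<Sum>k\<le>n. of_nat ((2 * n - k) choose n) * g k)"

text \<open>On generating functions, \<open>shift\<close> is multiplication by \<open>z\<close> and \<open>theta\<close> is \<open>z d/dz\<close>.\<close>

definition shift :: "(nat \<Rightarrow> complex) \<Rightarrow> nat \<Rightarrow> complex"
  where "shift g k = (case k of 0 \<Rightarrow> 0 | Suc j \<Rightarrow> g j)"

definition theta :: "(nat \<Rightarrow> complex) \<Rightarrow> nat \<Rightarrow> complex"
  where "theta g k = of_nat k * g k"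

lemma shift_simps [simp]: "shift g 0 = 0" "shift g (Suc k) = g k"
  by (simp_all add: shift_def)

lemma bsum_cong: "(\<And>k. k \<le> n \<Longrightarrow> f k = g k) \<Longrightarrow> bsum n f = bsum n g"
  by (auto simp: bsum_def intro!: sum.cong)

lemma bsum_add: "bsum n (\<lambda>k. f k + g k) = bsum n f + bsum n g"
  by (simp add: bsum_def ring_distribs sum.distrib)

lemma bsum_diff: "bsum n (\<lambda>k. f k - g k) = bsum n f - bsum n g"
  by (simp add: bsum_def ring_distribs sum_subtractf)

lemma bsum_scale: "bsum n (\<lambda>k. a * f k) = a * bsum n f"
  by (simp add: bsum_def sum_distrib_left mult_ac)

lemmas bsum_linear = bsum_add bsum_diff bsum_scale

lemma bsum_shift: "bsum n (shift g) = (\<Sum>k<n. of_nat ((2 * n - Suc k) choose n) * g k)"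
proof (cases n)
  case (Suc m)
  show ?thesis
    unfolding bsum_def Suc by (subst sum.atMost_Suc_shift) (simp add: lessThan_Suc_atMost)
qed (simp add: bsum_def)

text \<open>The added term k = n has weight \<open>(n - 1) choose n\<close>, which vanishes exactly
  because n > 0.\<close>

lemma bsum_shift_le: "n > 0 \<Longrightarrow> bsum n (shift g) = (\<Sum>k\<le>n. of_nat ((2 * n - Suc k) choose n) * g k)"
  by (simp add: bsum_shift flip: lessThan_Suc_atMost)

lemma bsum_shift_cong: "(\<And>k. k < n \<Longrightarrow> f k = g k) \<Longrightarrow> bsum n (shift f) = bsum n (shift g)"
  by (simp add: bsum_shift)

lemma shift_linear:
  "shift (\<lambda>k. f k + g k) = (\<lambda>k. shift f k + shift g k)"
  "shift (\<lambda>k. f k - g k) = (\<lambda>k. shift f k - shift g k)"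
  "shift (\<lambda>k. a * f k) = (\<lambda>k. a * shift f k)"
  by (auto simp: shift_def fun_eq_iff split: nat.split)

lemma theta_shift: "theta (shift g) = shift (\<lambda>k. g k + theta g k)"
  by (auto simp: shift_def theta_def fun_eq_iff ring_distribs split: nat.split)

lemma theta_linear:
  "theta (\<lambda>k. f k + g k) = (\<lambda>k. theta f k + theta g k)"
  "theta (\<lambda>k. f k - g k) = (\<lambda>k. theta f k - theta g k)"
  "theta (\<lambda>k. a * f k) = (\<lambda>k. a * theta f k)"
  by (auto simp: theta_def fun_eq_iff algebra_simps)

text \<open>The derivative of g / w^n has no residue. On coefficients this is an absorption identity
  between \<open>(2 * n - k) choose n\<close> and its lower neighbour.\<close>

lemma bsum_theta_diff:
  "bsum n (theta g) - bsum n (shift (theta g)) = of_nat n * (bsum n g - 2 * bsum n (shift g))"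
proof (cases "n = 0")
  case True
  then show ?thesis by (simp add: bsum_def theta_def)
next
  case False
  have *: "of_nat ((2 * n - k) choose n) * of_nat k - of_nat ((2 * n - Suc k) choose n) * of_nat k
      = of_nat n * (of_nat ((2 * n - k) choose n) - 2 * of_nat ((2 * n - Suc k) choose n) :: complex)"
    if "k \<le> n" for k
  proof -
    \<comment> \<open>For n > 0 and k \<le> n none of these natural subtractions truncates; for n =
      0 the term \<open>2 * n - Suc k\<close> would, hence the separate case.\<close>
    define m where "m = 2 * n - Suc k"
    have m: "2 * n - k = Suc m" "n \<le> Suc m" "k = 2 * n - Suc m" "Suc m \<le> 2 * n"
      using that False by (auto simp: m_def)
    have "(Suc m - n) * (Suc m choose n) = Suc m * (m choose n)"
      using binomial_absorb_comp[of "Suc m" n] by simp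
    then have "of_nat ((Suc m - n) * (Suc m choose n)) = (of_nat (Suc m * (m choose n)) :: complex)"
      by simp
    then have "(of_nat (Suc m) - of_nat n) * of_nat (Suc m choose n)
        = (of_nat (Suc m) * of_nat (m choose n) :: complex)"
      using m(2) by (simp only: of_nat_mult of_nat_diff)
    moreover have "of_nat k = (2 * of_nat n - of_nat (Suc m) :: complex)"
      using m by (simp add: of_nat_diff)
    ultimately show ?thesis
      unfolding m(1) m_def[symmetric] by algebra
  qed
  have "of_nat ((2 * n - k) choose n) * (of_nat k * g k) - of_nat ((2 * n - Suc k) choose n) * (of_nat k * g k)
      = of_nat n * (of_nat ((2 * n - k) choose n) * g k - 2 * (of_nat ((2 * n - Suc k) choose n) * g k))"
    if "k \<le> n" for k using *[OF that] by algebra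
  then show ?thesis
    unfolding bsum_shift_le[OF False[unfolded neq0_conv]] unfolding bsum_def theta_def sum_distrib_left sum_subtractf[symmetric]
    by (intro sum.cong) auto
qed

text \<open>Multiplication by w = z(1-z) cancels one factor of w^(n+2), here applied to z g - z (z
  g). On coefficients it is Pascal's rule.\<close>

lemma bsum_shift_shift: "bsum (Suc n) (shift g) - bsum (Suc n) (shift (shift g)) = bsum n g"
proof -
  have "bsum (Suc n) (shift (shift g)) = (\<Sum>k\<le>n. of_nat ((2 * n - k) choose Suc n) * g k)"
    unfolding bsum_shift by (subst sum.lessThan_Suc_shift)
      (simp flip: lessThan_Suc_atMost)
  moreover have "bsum (Suc n) (shift g) = (\<Sum>k\<le>n. of_nat ((2 * n - k) choose Suc n) * g k) + bsum n g"
    unfolding bsum_shift unfolding bsum_def sum.distrib[symmetric]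
    by (intro sum.cong) (auto simp: lessThan_Suc_atMost Suc_diff_le ring_distribs)
  ultimately show ?thesis by simp
qed

text \<open>Absorption: (2n+1-k) binom(2n-k, n) = (n+1) binom(2n+1-k, n+1). A factor k is thus
  traded for a step from n to n+1.\<close>

lemma bsum_theta_Suc:
  "bsum n (theta g) = (2 * of_nat n + 1) * bsum n g - of_nat (Suc n) * bsum (Suc n) (shift g)"
proof -
  have "of_nat ((2 * n - k) choose n) * (of_nat k * g k) =
     (2 * of_nat n + 1) * (of_nat ((2 * n - k) choose n) * g k)
       - of_nat (Suc n) * (of_nat ((2 * Suc n - Suc k) choose Suc n) * g k)" if "k \<le> n" for k
  proof -
    have 1: "2 * Suc n - Suc k = Suc (2 * n - k)"
      using that by simp
    have 2: "of_nat (Suc (2 * n - k)) = (2 * of_nat n + 1 - of_nat k :: complex)"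
      using that by (simp add: of_nat_diff)
    have "Suc n * (Suc (2 * n - k) choose Suc n) = Suc (2 * n - k) * ((2 * n - k) choose n)"
      by (rule Suc_times_binomial)
    then have "of_nat (Suc n) * of_nat (Suc (2 * n - k) choose Suc n)
        = (2 * of_nat n + 1 - of_nat k) * (of_nat ((2 * n - k) choose n) :: complex)"
      unfolding 2[symmetric] by (metis of_nat_mult)
    then show ?thesis unfolding 1 by algebra
  qed
  then show ?thesis
    unfolding bsum_shift lessThan_Suc_atMost
    unfolding bsum_def theta_def sum_distrib_left sum_subtractf[symmetric]
    by (intro sum.cong) auto
qed

section \<open>Sums of solutions of (1-z) g' = y g + r\<close>

context
  fixes n :: nat and y :: complex and g r :: "nat \<Rightarrow> complex"
  assumes rec: "\<And>k. k < n \<Longrightarrow> of_nat (Suc k) * g (Suc k) = (y + of_nat k) * g k + r k"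
begin

text \<open>The differential equation multiplied by z. It is stated up to n only, the range of
  coefficients that \<open>bsum n\<close> reads.\<close>

lemma theta_eq_shift: "k \<le> n \<Longrightarrow> theta g k = shift (\<lambda>k. theta g k + (y * g k + r k)) k"
  using rec by (cases k) (auto simp: theta_def algebra_simps)

lemma bsum_theta_rec:
  "bsum n (theta g) = bsum n (shift (theta g)) + y * bsum n (shift g) + bsum n (shift r)"
proof -
  have "bsum n (theta g) = bsum n (shift (\<lambda>k. theta g k + (y * g k + r k)))"
    by (rule bsum_cong) (rule theta_eq_shift)
  then show ?thesis by (simp add: shift_linear bsum_linear)
qed

text \<open>The equation and the derivative rule both evaluate the difference of
  \<open>bsum n (theta g)\<close> and \<open>bsum n (shift (theta g))\<close>; equating them leaves
  only g and r.\<close>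

lemma bsum_shift_rec: "(2 * of_nat n + y) * bsum n (shift g) = of_nat n * bsum n g - bsum n (shift r)"
  using bsum_theta_rec bsum_theta_diff[of n g] by algebra

lemma bsum_theta_theta_rec:
  "bsum n (theta (theta g)) = bsum n (shift (theta (theta g))) + (y + 1) * bsum n (shift (theta g))
     + y * bsum n (shift g) + bsum n (shift r) + bsum n (shift (theta r))"
proof -
  have "bsum n (theta (theta g)) = bsum n (theta (shift (\<lambda>k. theta g k + (y * g k + r k))))"
    by (rule bsum_cong) (simp add: theta_eq_shift theta_def[of "theta g"] theta_def[of "shift _"])
  then show ?thesis by (simp add: theta_shift shift_linear theta_linear bsum_linear algebra_simps)
qed

lemma bsum_theta_theta_theta_rec:
  "bsum n (theta (theta (theta g))) = bsum n (shift (theta (theta (theta g))))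
     + (y + 2) * bsum n (shift (theta (theta g))) + (2 * y + 1) * bsum n (shift (theta g))
     + y * bsum n (shift g)
     + bsum n (shift r) + 2 * bsum n (shift (theta r)) + bsum n (shift (theta (theta r)))"
proof -
  have "bsum n (theta (theta (theta g))) = bsum n (theta (theta (shift (\<lambda>k. theta g k + (y * g k + r k)))))"
    by (rule bsum_cong) (simp add: theta_eq_shift theta_def[of "theta (theta g)"]
        theta_def[of "theta g"] theta_def[of "shift _"] theta_def[of "theta (shift _)"])
  then show ?thesis by (simp add: theta_shift shift_linear theta_linear bsum_linear algebra_simps)
qed

text \<open>Linear elimination: the derivative rule for g and for \<open>theta g\<close>, against
  the equation and its image under \<open>theta\<close>, removes every shifted sum of g.\<close>

lemma bsum_theta_rec_solved:
  "(of_nat n + y + 1) * bsum n (theta g)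
     = y * of_nat n * bsum n g + 2 * of_nat n * bsum n (shift r) - bsum n (shift (theta r))"
  using bsum_theta_rec bsum_theta_theta_rec bsum_theta_diff[of n "theta g"] bsum_theta_diff[of n g]
  by algebra

text \<open>The same elimination one order higher. The sums of \<open>shift (theta g)\<close> and
  \<open>shift g\<close> stay, being known by then.\<close>

lemma bsum_theta_theta_rec_solved:
  "(of_nat n + y + 2) * bsum n (theta (theta g))
     = (2 * of_nat n * (y + 1) + y\<^sup>2 + y + 1) * bsum n (shift (theta g))
       + (2 * of_nat n + y + 1) * y * bsum n (shift g)
       + (2 * of_nat n + y + 2) * (bsum n (shift r) + bsum n (shift (theta r)))
       - (bsum n (shift r) + 2 * bsum n (shift (theta r)) + bsum n (shift (theta (theta r))))"
  using bsum_theta_theta_rec bsum_theta_theta_theta_rec bsum_theta_diff[of n "theta (theta g)"]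
  by algebra

end

text \<open>The equation times z, read at level n+1: \<open>bsum_shift_shift\<close> lowers the
  differences of shifts to level n, and \<open>bsum_theta_Suc\<close> removes the remaining
  \<open>theta\<close>.\<close>

lemma bsum_shift_Suc_rec:
  assumes rec: "\<And>k. k \<le> n \<Longrightarrow> of_nat (Suc k) * g (Suc k) = (y + of_nat k) * g k + r k"
  shows "(of_nat n + 1 + y) * bsum (Suc n) (shift g)
    = (2 * of_nat n + 1 + y) * bsum n g - bsum (Suc n) (shift r) + bsum n r"
proof -
  have "bsum (Suc n) (shift (theta g)) = bsum (Suc n) (shift (shift (\<lambda>k. theta g k + (y * g k + r k))))"
    by (rule bsum_shift_cong) (rule theta_eq_shift[of n], auto simp: rec simp del: of_nat_Suc)
  then have "bsum (Suc n) (shift (theta g)) = bsum (Suc n) (shift (shift (theta g)))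
      + y * bsum (Suc n) (shift (shift g)) + bsum (Suc n) (shift (shift r))"
    by (simp add: shift_linear bsum_linear)
  then show ?thesis
    using bsum_shift_shift[of n "theta g"] bsum_shift_shift[of n g] bsum_shift_shift[of n r]
      bsum_theta_Suc[of n g] unfolding of_nat_Suc by algebra
qed

lemma bsum_Suc_rec:
  assumes rec: "\<And>k. k \<le> n \<Longrightarrow> of_nat (Suc k) * g (Suc k) = (y + of_nat k) * g k + r k"
  shows "of_nat (Suc n) * (of_nat n + 1 + y) * bsum (Suc n) g
    = (2 * of_nat n + 2 + y) * ((2 * of_nat n + 1 + y) * bsum n g + bsum n r)
      - of_nat (Suc n) * bsum (Suc n) (shift r)"
proof -
  have "(2 * of_nat (Suc n) + y) * bsum (Suc n) (shift g)
      = of_nat (Suc n) * bsum (Suc n) g - bsum (Suc n) (shift r)"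
    by (rule bsum_shift_rec) (simp add: rec less_Suc_eq_le del: of_nat_Suc)
  moreover have "(of_nat n + 1 + y) * bsum (Suc n) (shift g)
      = (2 * of_nat n + 1 + y) * bsum n g - bsum (Suc n) (shift r) + bsum n r"
    by (rule bsum_shift_Suc_rec) (rule rec)
  ultimately show ?thesis unfolding of_nat_Suc by algebra
qed

section \<open>The concrete sequences and their recurrences\<close>

text \<open>For j = 0 the generating function is (1-z)^(-x-1), so the equation holds with y = x+1
  for every j.\<close>

definition binom_harm :: "complex \<Rightarrow> nat \<Rightarrow> nat \<Rightarrow> complex"
  where "binom_harm x j k = ((x + of_nat k) gchoose k) * harm1 k x ^ j"

definition binom_quot :: "complex \<Rightarrow> nat \<Rightarrow> complex"
  where "binom_quot x k = ((x + of_nat k) gchoose k) / (x + 1 + of_nat k)"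

definition central_gchoose :: "complex \<Rightarrow> nat \<Rightarrow> complex"
  where "central_gchoose x n = (x + 2 * of_nat n + 1) gchoose n"

text \<open>The logarithmic derivative of \<open>central_gchoose x n\<close> with respect to
  x.\<close>

definition harm_gap :: "complex \<Rightarrow> nat \<Rightarrow> complex"
  where "harm_gap x n = harm1 (2 * n + 1) x - harm1 (n + 1) x"

text \<open>Equals the sum of \<open>(-1)^(k-1) / (x+k)\<close> over \<open>1 \<le> k \<le> 2n+1\<close>.\<close>

definition alt_harm :: "complex \<Rightarrow> nat \<Rightarrow> complex"
  where "alt_harm x n = (harm1 (n + 1) ((x - 1) / 2) - harm1 n (x / 2)) / 2"

text \<open>The cofactor of \<open>central_gchoose x n\<close> in the sum of
  \<open>binom_harm x 2\<close>; the second-order harmonic numbers make it vanish at n = 0.\<close>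

definition harm_quad :: "complex \<Rightarrow> nat \<Rightarrow> complex"
  where "harm_quad x n = (harm_gap x n)\<^sup>2 - (alt_harm x n)\<^sup>2 / 2
     - gen_harm 2 (2 * n + 1) x / 2 + gen_harm 2 (n + 1) x"

lemma gen_harm_0 [simp]: "gen_harm l 0 x = 0"
  by (simp add: gen_harm_def)

lemma gen_harm_Suc: "gen_harm l (Suc n) x = gen_harm l n x + 1 / (x + 1 + of_nat n) ^ l"
  by (simp add: gen_harm_def add_ac)

lemma harm_gap_0 [simp]: "harm_gap x 0 = 0"
  by (simp add: harm_gap_def)

lemma harm_gap_Suc: "harm_gap x (Suc n) = harm_gap x n + 1 / (x + 2 * of_nat n + 2)
   + 1 / (x + 2 * of_nat n + 3) - 1 / (x + of_nat n + 2)"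
  by (simp add: harm_gap_def gen_harm_Suc add_ac)

lemma alt_harm_0 [simp]: "alt_harm x 0 = 1 / (x + 1)"
proof -
  have "(x - 1) / 2 + 1 = (x + 1) / 2" by (simp add: field_simps)
  then show ?thesis by (simp add: alt_harm_def gen_harm_Suc)
qed

lemma alt_harm_Suc: "alt_harm x (Suc n) = alt_harm x n - 1 / (x + 2 * of_nat n + 2)
   + 1 / (x + 2 * of_nat n + 3)"
proof -
  have "x / 2 + 1 + of_nat n = (x + 2 * of_nat n + 2) / 2"
    "(x - 1) / 2 + 1 + of_nat (Suc n) = (x + 2 * of_nat n + 3) / 2"
    by (simp_all add: field_simps)
  then show ?thesis
    by (simp add: alt_harm_def gen_harm_Suc del: of_nat_Suc) (simp add: field_simps)
qed

text \<open>The trailing 0 is the inhomogeneity r, kept so that the statement unifies with the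
  general recurrence.\<close>

lemma binom_harm_0_Suc:
  "of_nat (Suc k) * binom_harm x 0 (Suc k) = (x + 1 + of_nat k) * binom_harm x 0 k + 0"
proof -
  have "x + of_nat (Suc k) = (x + of_nat k) + 1" by simp
  then have "binom_harm x 0 (Suc k) = ((x + of_nat k) + 1) / of_nat (Suc k) * binom_harm x 0 k"
    unfolding binom_harm_def by (simp only: gbinomial_factors) simp
  then show ?thesis by (simp add: add_ac del: of_nat_Suc)
qed

lemma binom_harm_1_Suc:
  assumes "x + 1 + of_nat k \<noteq> 0"
  shows "of_nat (Suc k) * binom_harm x 1 (Suc k) = (x + 1 + of_nat k) * binom_harm x 1 k + binom_harm x 0 k"
proof -
  have "of_nat (Suc k) * binom_harm x 1 (Suc k) = (of_nat (Suc k) * binom_harm x 0 (Suc k)) * harm1 (Suc k) x"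
    by (simp add: binom_harm_def)
  also have "\<dots> = binom_harm x 0 k * ((x + 1 + of_nat k) * harm1 (Suc k) x)"
    unfolding binom_harm_0_Suc by simp
  also have "(x + 1 + of_nat k) * harm1 (Suc k) x = (x + 1 + of_nat k) * harm1 k x + 1"
    using assms by (simp add: gen_harm_Suc distrib_left)
  finally show ?thesis by (simp add: binom_harm_def algebra_simps)
qed

lemma binom_harm_2_Suc:
  assumes "x + 1 + of_nat k \<noteq> 0"
  shows "of_nat (Suc k) * binom_harm x 2 (Suc k)
    = (x + 1 + of_nat k) * binom_harm x 2 k + (2 * binom_harm x 1 k + binom_quot x k)"
proof -
  have "of_nat (Suc k) * binom_harm x 2 (Suc k) = (of_nat (Suc k) * binom_harm x 0 (Suc k)) * (harm1 (Suc k) x)\<^sup>2"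
    by (simp add: binom_harm_def)
  also have "\<dots> = binom_harm x 0 k * ((x + 1 + of_nat k) * (harm1 (Suc k) x)\<^sup>2)"
    unfolding binom_harm_0_Suc by simp
  also have "(x + 1 + of_nat k) * (harm1 (Suc k) x)\<^sup>2
      = (x + 1 + of_nat k) * (harm1 k x)\<^sup>2 + 2 * harm1 k x + 1 / (x + 1 + of_nat k)"
  proof -
    have "(x + 1 + of_nat k) * (1 / (x + 1 + of_nat k)) = 1"
      using assms by simp
    then show ?thesis unfolding gen_harm_Suc power_one_right by algebra
  qed
  finally show ?thesis by (simp add: binom_harm_def binom_quot_def algebra_simps)
qed

text \<open>Write k = (x+1+k) - (x+1). This replaces a recurrence in k for
  \<open>binom_quot\<close>: each \<open>theta\<close> reduces to \<open>binom_harm x 0\<close> and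
  \<open>binom_quot\<close> itself.\<close>

lemma theta_binom_quot:
  assumes "x + 1 + of_nat k \<noteq> 0"
  shows "theta (binom_quot x) k = binom_harm x 0 k - (x + 1) * binom_quot x k"
  using assms by (simp add: theta_def binom_quot_def binom_harm_def divide_simps) (simp add: algebra_simps)

text \<open>This is the homogeneous part of \<open>bsum_Suc_rec\<close> at y = x+1, so division by
  \<open>central_gchoose\<close> makes the recurrences telescope.\<close>

lemma central_gchoose_Suc:
  "of_nat (Suc n) * (x + of_nat n + 2) * central_gchoose x (Suc n)
     = (x + 2 * of_nat n + 2) * (x + 2 * of_nat n + 3) * central_gchoose x n"
proof -
  let ?y = "x + 2 * of_nat n + 2"
  have 1: "of_nat (Suc n) * central_gchoose x (Suc n) = (?y + 1) * (?y gchoose n)"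
  proof -
    have "x + 2 * of_nat (Suc n) + 1 = ?y + 1" by simp
    then show ?thesis
      unfolding central_gchoose_def by (simp only: gbinomial_factors) (simp del: of_nat_Suc)
  qed
  have 2: "(?y - of_nat n) * (?y gchoose n) = ?y * central_gchoose x n"
    using gbinomial_absorb_comp[of ?y n] by (simp add: central_gchoose_def add_ac)
  from 1 2 show ?thesis by algebra
qed

lemma bsum_0 [simp]: "bsum 0 g = g 0"
  by (simp add: bsum_def)

lemma theta_zero [simp]: "theta (\<lambda>k. 0) = (\<lambda>k. 0)"
  by (simp add: theta_def fun_eq_iff)

lemma bsum_zero [simp]: "bsum n (\<lambda>k. 0) = 0"
  by (simp add: bsum_def)

lemma bsum_shift_zero [simp]: "bsum n (shift (\<lambda>k. 0)) = 0"
  by (simp add: bsum_shift)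

text \<open>
  In the next two lemmas \<open>M = x+2N+1\<close>, \<open>P = x+N+2\<close>, \<open>Q = x+N+3\<close>; solving for \<open>x\<close> and \<open>N\<close> turns the
  claims, after clearing denominators, into polynomial identities in independent variables.
\<close>

lemma shift_theta_theta_elim:
  fixes x N c D M P Q u b0 b1 s0 s1 ps0 :: complex
  assumes nz: "M \<noteq> 0" "P \<noteq> 0" "Q \<noteq> 0" and x: "x = 2 * P - M - 3" and N: "N = M - P + 1" and Q: "Q = P + 1"
  and b0: "b0 = N * c / M" and b1: "b1 = N * c / M * (D - 1 / M)"
  and s0: "s0 = (x + 1) * N * (N - 1) * c / P / M"
  and s1: "s1 = N * (N - 1) * c / P / M * ((x + 1) * (D - 1 / P - 1 / M) + 1)"
  and ps0: "ps0 = (x + 1) * N * (N - 1) * ((x + 3) * N - x - 1) * c / P / Q / M"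
  and u: "Q * u = (2 * N * (x + 1 + 1) + (x + 1)\<^sup>2 + (x + 1) + 1) * s1 + (2 * N + (x + 1) + 1) * (x + 1) * b1
    + (2 * N + (x + 1) + 2) * (b0 + s0) - (b0 + 2 * s0 + ps0)"
  shows "u - (x + 2) * s1 - (x + 1) * b1 - b0 - s0 = N * (N - 1) * c / P / Q / M
     * ((x + 1) * ((x + 3) * N - x - 1) * (D - 1 / P - 1 / Q - 1 / M) + (2 * x + 4) * N - 2 * x - 2)"
proof -
  have "Q * (u - (x + 2) * s1 - (x + 1) * b1 - b0 - s0) = Q * (N * (N - 1) * c / P / Q / M
     * ((x + 1) * ((x + 3) * N - x - 1) * (D - 1 / P - 1 / Q - 1 / M) + (2 * x + 4) * N - 2 * x - 2))"
    unfolding right_diff_distrib u b0 b1 s0 s1 ps0 using nz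
    apply (simp add: divide_simps)
    unfolding x N Q by algebra
  with \<open>Q \<noteq> 0\<close> show ?thesis by (simp only: mult_cancel_left) simp
qed

lemma theta_theta_elim:
  fixes x N c D E F M P Q u t b s b0 b1 s0 s1 ps1 bq r r1 r2 :: complex
  assumes nz: "M \<noteq> 0" "P \<noteq> 0" "Q \<noteq> 0" and x: "x = 2 * P - M - 3" and N: "N = M - P + 1" and Q: "Q = P + 1"
  and b0: "b0 = N * c / M" and b1: "b1 = N * c / M * (D - 1 / M)"
  and s0: "s0 = (x + 1) * N * (N - 1) * c / P / M"
  and s1: "s1 = N * (N - 1) * c / P / M * ((x + 1) * (D - 1 / P - 1 / M) + 1)"
  and ps1: "ps1 = N * (N - 1) * c / P / Q / M
     * ((x + 1) * ((x + 3) * N - x - 1) * (D - 1 / P - 1 / Q - 1 / M) + (2 * x + 4) * N - 2 * x - 2)"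
  and bq: "bq = (x + N + 1) * c / M * (E - 1 / M)"
  and r: "r = 2 * b1 + bq"
  and r1: "r1 = 2 * s1 + (b0 - (x + 1) * bq)"
  and r2: "r2 = 2 * ps1 + (s0 - (x + 1) * (b0 - (x + 1) * bq))"
  and t: "P * t = (x + 1) * N * (c * F) + 2 * N * r - r1"
  and b: "M * b = N * (c * F) - r"
  and s: "t = s + (x + 1) * b + r"
  and u: "Q * u = (2 * N * (x + 1 + 1) + (x + 1)\<^sup>2 + (x + 1) + 1) * s + (2 * N + (x + 1) + 1) * (x + 1) * b
    + (2 * N + (x + 1) + 2) * (r + r1) - (r + 2 * r1 + r2)"
  shows "u = c / P / Q *
   (N * ((x + 1) * (x * N + 3 * N + 1)
        * (F - 2 * (1 / P + 1 / Q) * D + (1 / P + 1 / Q)\<^sup>2 + (1 / P)\<^sup>2 + (1 / Q)\<^sup>2)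
      - 2 * (1 / P + 1 / Q - D) * (2 * x * N + 4 * N + 1))
    - E * (x + N + 1) * (x\<^sup>2 + 3 * x - 2 * N + 1)
    + (x\<^sup>2 + 3 * x + 3 * N ^ 2 - N + 1))" (is "u = ?R")
proof -
  \<comment> \<open>The sums t, b, s are known only through P t, M b and a linear relation, so they
    are eliminated under the common factor M P Q before the explicit values enter.\<close>
  have "M * P * Q * u = (2 * N * (x + 1 + 1) + (x + 1)\<^sup>2 + (x + 1) + 1) *
     (M * ((x + 1) * N * (c * F) + 2 * N * r - r1) - (x + 1) * P * (N * (c * F) - r) - M * P * r)
    + (2 * N + (x + 1) + 1) * (x + 1) * P * (N * (c * F) - r)
    + M * P * ((2 * N + (x + 1) + 2) * (r + r1) - (r + 2 * r1 + r2))"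
    using t b s u by algebra
  also have "\<dots> = M * P * Q * ?R"
    unfolding r r1 r2 b0 b1 s0 s1 ps1 bq using nz
    apply (simp add: divide_simps)
    unfolding x N Q by algebra
  finally show ?thesis using nz by (simp only: mult_cancel_left) simp
qed

section \<open>Closed forms for the sums\<close>

context
  fixes x :: complex and n :: nat
  assumes nz: "\<And>k. k \<in> {1..2*n+1} \<Longrightarrow> x + of_nat k \<noteq> 0"
begin

lemma nz_Suc: "k \<le> 2 * n \<Longrightarrow> x + 1 + of_nat k \<noteq> 0"
  using nz[of "Suc k"] by (simp add: add_ac)

lemma nz_odd: "m \<le> n \<Longrightarrow> x + 2 * of_nat m + 1 \<noteq> 0"
  using nz[of "2 * m + 1"] by (simp add: add_ac)

lemma nz_step:
  assumes "Suc m \<le> n"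
  shows "of_nat (Suc m) * (x + of_nat m + 2) \<noteq> 0" "x + 2 * of_nat m + 2 \<noteq> 0" "x + 2 * of_nat m + 3 \<noteq> 0"
    "x + of_nat m + 2 \<noteq> 0"
proof -
  show "x + 2 * of_nat m + 2 \<noteq> 0" "x + 2 * of_nat m + 3 \<noteq> 0" and *: "x + of_nat m + 2 \<noteq> 0"
    using assms nz[of "2*m+2"] nz[of "2*m+3"] nz[of "m+2"] by (simp_all add: add_ac)
  then show "of_nat (Suc m) * (x + of_nat m + 2) \<noteq> 0"
    by (simp del: of_nat_Suc)
qed

text \<open>From n \<ge> 2 follows n+3 \<le> 2n+1, so both factors are among those assumed
  nonzero.\<close>

lemma nz_shifted:
  assumes "n \<ge> 2"
  shows "x + of_nat n + 2 \<noteq> 0" "x + of_nat n + 3 \<noteq> 0"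
  using assms nz[of "n+2"] nz[of "n+3"] by (auto simp: add_ac)

lemma binom_harm_1_rec:
  "k < n \<Longrightarrow> of_nat (Suc k) * binom_harm x 1 (Suc k) = (x + 1 + of_nat k) * binom_harm x 1 k + binom_harm x 0 k"
  using nz_Suc by (intro binom_harm_1_Suc) simp

lemma binom_harm_2_rec:
  "k < n \<Longrightarrow> of_nat (Suc k) * binom_harm x 2 (Suc k)
    = (x + 1 + of_nat k) * binom_harm x 2 k + (2 * binom_harm x 1 k + binom_quot x k)"
  using nz_Suc by (intro binom_harm_2_Suc) simp

lemma bsum_binom_harm_0: "m \<le> n \<Longrightarrow> bsum m (binom_harm x 0) = central_gchoose x m"
proof (induction m)
  case 0
  show ?case by (simp add: binom_harm_def central_gchoose_def)
next
  case (Suc m)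
  note nz = nz_step[OF Suc.prems]
  have IH: "bsum m (binom_harm x 0) = central_gchoose x m"
    using Suc by simp
  have "of_nat (Suc m) * (x + of_nat m + 2) * bsum (Suc m) (binom_harm x 0)
     = of_nat (Suc m) * (x + of_nat m + 2) * central_gchoose x (Suc m)"
    using bsum_Suc_rec[of m "binom_harm x 0" "x + 1" "\<lambda>k. 0", OF binom_harm_0_Suc]
    unfolding central_gchoose_Suc IH[symmetric] bsum_zero bsum_shift_zero by algebra
  with nz(1) show ?case by simp
qed

lemma bsum_shift_binom_harm_0:
  assumes "m \<le> n"
  shows "bsum m (shift (binom_harm x 0)) = of_nat m * central_gchoose x m / (x + 2 * of_nat m + 1)"
proof -
  have "(x + 2 * of_nat m + 1) * bsum m (shift (binom_harm x 0)) = of_nat m * central_gchoose x m"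
    using bsum_shift_rec[of m "binom_harm x 0" "x + 1" "\<lambda>k. 0", OF binom_harm_0_Suc]
    unfolding bsum_binom_harm_0[OF assms] by (simp add: add_ac)
  then show ?thesis using nz_odd[OF assms] by (simp add: nonzero_eq_divide_eq mult_ac)
qed

text \<open>Formally the x-derivative of \<open>bsum_binom_harm_0\<close>, as binom(x+k, k) has
  derivative \<open>binom_harm x 1 k\<close>. The proof telescopes the recurrence with r =
  \<open>binom_harm x 0\<close>.\<close>

lemma bsum_binom_harm_1: "m \<le> n \<Longrightarrow> bsum m (binom_harm x 1) = central_gchoose x m * harm_gap x m"
proof (induction m)
  case 0
  show ?case by (simp add: binom_harm_def)
next
  case (Suc m)
  note nz = nz_step[OF Suc.prems]
  have IH: "bsum m (binom_harm x 1) = central_gchoose x m * harm_gap x m"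
    and le: "m \<le> n" using Suc by simp_all
  \<comment> \<open>The reciprocals become variables subject to polynomial relations, which brings
    the division-free goal within reach of \<open>algebra\<close>.\<close>
  define a b d where "a = 1 / (x + 2 * of_nat m + 2)" "b = 1 / (x + 2 * of_nat m + 3)"
    "d = 1 / (x + of_nat m + 2)"
  have abd: "a * (x + 2 * of_nat m + 2) = 1" "b * (x + 2 * of_nat m + 3) = 1" "d * (x + of_nat m + 2) = 1"
    using nz by (simp_all add: a_b_d_def)
  have *: "of_nat (Suc m) * (of_nat m + 1 + (x + 1)) * bsum (Suc m) (binom_harm x 1)
    = (2 * of_nat m + 2 + (x + 1)) * ((2 * of_nat m + 1 + (x + 1)) * bsum m (binom_harm x 1)
       + bsum m (binom_harm x 0)) - of_nat (Suc m) * bsum (Suc m) (shift (binom_harm x 0))"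
    by (rule bsum_Suc_rec) (use le nz_Suc in \<open>auto simp: binom_harm_1_Suc simp del: of_nat_Suc One_nat_def\<close>)
  have **: "bsum (Suc m) (shift (binom_harm x 0)) = of_nat (Suc m) * central_gchoose x (Suc m) * b"
    using bsum_shift_binom_harm_0[OF Suc.prems] by (simp add: a_b_d_def add_ac)
  have H: "harm_gap x (Suc m) = harm_gap x m + a + b - d"
    by (simp add: harm_gap_Suc a_b_d_def)
  have "of_nat (Suc m) * (x + of_nat m + 2) * bsum (Suc m) (binom_harm x 1)
     = of_nat (Suc m) * (x + of_nat m + 2) * (central_gchoose x (Suc m) * harm_gap x (Suc m))"
    using * abd central_gchoose_Suc[of m x]
    unfolding ** IH H bsum_binom_harm_0[OF le] of_nat_Suc by algebra
  with nz(1) show ?case by simp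
qed

lemma bsum_shift_binom_harm_1:
  assumes "m \<le> n"
  shows "bsum m (shift (binom_harm x 1)) = of_nat m * central_gchoose x m / (x + 2 * of_nat m + 1)
    * (harm_gap x m - 1 / (x + 2 * of_nat m + 1))"
proof -
  have "(2 * of_nat m + (x + 1)) * bsum m (shift (binom_harm x 1))
      = of_nat m * bsum m (binom_harm x 1) - bsum m (shift (binom_harm x 0))"
    by (rule bsum_shift_rec) (use assms nz_Suc in \<open>auto simp: binom_harm_1_Suc simp del: of_nat_Suc One_nat_def\<close>)
  then show ?thesis using nz_odd[OF assms]
    unfolding bsum_binom_harm_1[OF assms] bsum_shift_binom_harm_0[OF assms]
    by (simp add: divide_simps) algebra
qed

lemma bsum_theta_binom_quot:
  "m \<le> n \<Longrightarrow> bsum m (theta (binom_quot x)) = central_gchoose x m - (x + 1) * bsum m (binom_quot x)"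
  using bsum_cong[of m "theta (binom_quot x)" "\<lambda>k. binom_harm x 0 k - (x + 1) * binom_quot x k"]
  by (simp add: theta_binom_quot nz_Suc bsum_linear bsum_binom_harm_0)

lemma bsum_shift_theta_binom_quot:
  "m \<le> n \<Longrightarrow> bsum m (shift (theta (binom_quot x)))
     = bsum m (shift (binom_harm x 0)) - (x + 1) * bsum m (shift (binom_quot x))"
  using bsum_shift_cong[of m "theta (binom_quot x)" "\<lambda>k. binom_harm x 0 k - (x + 1) * binom_quot x k"]
  by (simp add: theta_binom_quot nz_Suc bsum_linear shift_linear)

lemma bsum_shift_theta_theta_binom_quot:
  "m \<le> n \<Longrightarrow> bsum m (shift (theta (theta (binom_quot x))))
     = bsum m (shift (theta (binom_harm x 0))) - (x + 1) * bsum m (shift (theta (binom_quot x)))"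
proof -
  assume m: "m \<le> n"
  have "bsum m (shift (theta (theta (binom_quot x))))
      = bsum m (shift (theta (\<lambda>k. binom_harm x 0 k - (x + 1) * binom_quot x k)))"
  proof (rule bsum_shift_cong)
    fix k assume "k < m"
    then show "theta (theta (binom_quot x)) k = theta (\<lambda>k. binom_harm x 0 k - (x + 1) * binom_quot x k) k"
      using m theta_binom_quot[OF nz_Suc[of k]]
      by (simp only: theta_def[of "theta (binom_quot x)"] theta_def[of "\<lambda>k. _ k - _ k"])
  qed
  then show ?thesis
    by (simp add: theta_linear shift_linear bsum_linear)
qed

text \<open>The derivative rule for \<open>binom_quot\<close>, with both \<open>theta\<close> terms
  rewritten by \<open>theta_binom_quot\<close>.\<close>

lemma bsum_shift_binom_quot':
  assumes "m \<le> n"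
  shows "(x + 2 * of_nat m + 1) * bsum m (shift (binom_quot x))
    = (x + of_nat m + 1) * (bsum m (binom_quot x) - central_gchoose x m / (x + 2 * of_nat m + 1))"
  using bsum_theta_diff[of m "binom_quot x"] nz_odd[OF assms]
  unfolding bsum_theta_binom_quot[OF assms] bsum_shift_theta_binom_quot[OF assms] bsum_shift_binom_harm_0[OF assms]
  by (simp add: divide_simps) algebra

lemma bsum_binom_quot: "m \<le> n \<Longrightarrow> bsum m (binom_quot x) = central_gchoose x m * alt_harm x m"
proof (induction m)
  case 0
  show ?case by (simp add: binom_quot_def central_gchoose_def)
next
  case (Suc m)
  note nz = nz_step[OF Suc.prems]
  have IH: "bsum m (binom_quot x) = central_gchoose x m * alt_harm x m"
    and le: "m \<le> n" using Suc by simp_all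
  define a b where "a = 1 / (x + 2 * of_nat m + 2)" "b = 1 / (x + 2 * of_nat m + 3)"
  have ab: "a * (x + 2 * of_nat m + 2) = 1" "b * (x + 2 * of_nat m + 3) = 1"
    using nz by (simp_all add: a_b_def)
  have H: "alt_harm x (Suc m) = alt_harm x m - a + b"
    by (simp add: alt_harm_Suc a_b_def)
  have *: "(x + 2 * of_nat m + 3) * bsum (Suc m) (shift (binom_quot x))
      = (x + of_nat m + 2) * (bsum (Suc m) (binom_quot x) - central_gchoose x (Suc m) * b)"
    using bsum_shift_binom_quot'[OF Suc.prems] by (simp add: a_b_def add_ac)
  \<comment> \<open>\<open>bsum_theta_Suc\<close> links levels m and m+1; its \<open>theta\<close>
    term is already explicit, and * converts the shifted sum at level m+1.\<close>
  have "of_nat (Suc m) * (x + of_nat m + 2) * bsum (Suc m) (binom_quot x)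
     = of_nat (Suc m) * (x + of_nat m + 2) * (central_gchoose x (Suc m) * alt_harm x (Suc m))"
    using * ab central_gchoose_Suc[of m x] bsum_theta_Suc[of m "binom_quot x"]
    unfolding bsum_theta_binom_quot[OF le] IH H of_nat_Suc by algebra
  with nz(1) show ?case by simp
qed

lemma bsum_shift_binom_quot:
  assumes "m \<le> n"
  shows "bsum m (shift (binom_quot x)) = (x + of_nat m + 1) * central_gchoose x m / (x + 2 * of_nat m + 1)
    * (alt_harm x m - 1 / (x + 2 * of_nat m + 1))"
  using bsum_shift_binom_quot'[OF assms] nz_odd[OF assms] unfolding bsum_binom_quot[OF assms]
  by (simp add: divide_simps) algebra

lemma bsum_binom_harm_2: "m \<le> n \<Longrightarrow> bsum m (binom_harm x 2) = central_gchoose x m * harm_quad x m"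
proof (induction m)
  case 0
  show ?case by (simp add: binom_harm_def harm_quad_def gen_harm_Suc power_divide)
next
  case (Suc m)
  note nz = nz_step[OF Suc.prems]
  have IH: "bsum m (binom_harm x 2) = central_gchoose x m * harm_quad x m"
    and le: "m \<le> n" using Suc by simp_all
  define a b d where "a = 1 / (x + 2 * of_nat m + 2)" "b = 1 / (x + 2 * of_nat m + 3)"
    "d = 1 / (x + of_nat m + 2)"
  have abd: "a * (x + 2 * of_nat m + 2) = 1" "b * (x + 2 * of_nat m + 3) = 1" "d * (x + of_nat m + 2) = 1"
    using nz by (simp_all add: a_b_d_def)
  let ?r = "\<lambda>k. 2 * binom_harm x 1 k + binom_quot x k"
  have *: "of_nat (Suc m) * (of_nat m + 1 + (x + 1)) * bsum (Suc m) (binom_harm x 2)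
    = (2 * of_nat m + 2 + (x + 1)) * ((2 * of_nat m + 1 + (x + 1)) * bsum m (binom_harm x 2)
       + bsum m ?r) - of_nat (Suc m) * bsum (Suc m) (shift ?r)"
    by (rule bsum_Suc_rec) (use le nz_Suc in \<open>auto simp: binom_harm_2_Suc simp del: of_nat_Suc\<close>)
  have r: "bsum m ?r = central_gchoose x m * (2 * harm_gap x m + alt_harm x m)"
    by (simp add: bsum_linear bsum_binom_harm_1[OF le] bsum_binom_quot[OF le] algebra_simps del: One_nat_def)
  have H: "harm_gap x (Suc m) = harm_gap x m + a + b - d" "alt_harm x (Suc m) = alt_harm x m - a + b"
    by (simp_all add: harm_gap_Suc alt_harm_Suc a_b_d_def)
  have b: "inverse (x + 2 * of_nat (Suc m) + 1) = b"
    by (simp add: a_b_d_def add_ac inverse_eq_divide)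
  have "bsum (Suc m) (shift ?r) = central_gchoose x (Suc m) * b *
      (2 * of_nat (Suc m) * (harm_gap x (Suc m) - b) + (x + of_nat m + 2) * (alt_harm x (Suc m) - b))"
    unfolding shift_linear bsum_linear bsum_shift_binom_harm_1[OF Suc.prems] bsum_shift_binom_quot[OF Suc.prems]
    unfolding divide_inverse b by (simp add: algebra_simps)
  \<comment> \<open>The b in each increment cancels the subtracted b.\<close>
  then have sr: "bsum (Suc m) (shift ?r) = central_gchoose x (Suc m) * b *
      (2 * of_nat (Suc m) * (harm_gap x m + a - d) + (x + of_nat m + 2) * (alt_harm x m - a))"
    unfolding H by simp
  have Q: "2 * harm_quad x (Suc m) = 2 * harm_quad x m + 2 * ((harm_gap x m + a + b - d)\<^sup>2 - (harm_gap x m)\<^sup>2)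
     - ((alt_harm x m - a + b)\<^sup>2 - (alt_harm x m)\<^sup>2) - a\<^sup>2 - b\<^sup>2 + 2 * d\<^sup>2"
    unfolding harm_quad_def H
    by (simp add: gen_harm_Suc add_ac a_b_d_def power_divide) (simp add: algebra_simps)
  \<comment> \<open>Doubling clears the halves in \<open>harm_quad\<close>.\<close>
  have "2 * (of_nat (Suc m) * (x + of_nat m + 2) * bsum (Suc m) (binom_harm x 2))
     = of_nat (Suc m) * (x + of_nat m + 2) * (central_gchoose x (Suc m) * (2 * harm_quad x (Suc m)))"
    using * abd central_gchoose_Suc[of m x]
    unfolding sr r IH Q of_nat_Suc by algebra
  with nz(1) show ?case by simp
qed

text \<open>The sum of \<open>theta g\<close> comes from the solved form; the equation then yields
  its shifted version. The next lemmas repeat this pattern.\<close>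

lemma bsum_shift_theta_binom_harm_0:
  "n \<ge> 2 \<Longrightarrow> bsum n (shift (theta (binom_harm x 0)))
     = (x + 1) * of_nat n * (of_nat n - 1) * central_gchoose x n
       / (x + of_nat n + 2) / (x + 2 * of_nat n + 1)"
  using bsum_theta_rec_solved[of n "binom_harm x 0" "x + 1" "\<lambda>k. 0", OF binom_harm_0_Suc]
    bsum_theta_rec[of n "binom_harm x 0" "x + 1" "\<lambda>k. 0", OF binom_harm_0_Suc]
    nz_odd[OF order_refl] nz_shifted
  unfolding theta_zero bsum_shift_zero bsum_shift_binom_harm_0[OF order_refl] bsum_binom_harm_0[OF order_refl]
  by (simp add: divide_simps) algebra

lemma bsum_shift_theta_theta_binom_harm_0:
  "n \<ge> 2 \<Longrightarrow> bsum n (shift (theta (theta (binom_harm x 0))))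
     = (x + 1) * of_nat n * (of_nat n - 1) * ((x + 3) * of_nat n - x - 1) * central_gchoose x n
       / (x + of_nat n + 2) / (x + of_nat n + 3) / (x + 2 * of_nat n + 1)"
  using bsum_theta_theta_rec_solved[of n "binom_harm x 0" "x + 1" "\<lambda>k. 0", OF binom_harm_0_Suc]
    bsum_theta_theta_rec[of n "binom_harm x 0" "x + 1" "\<lambda>k. 0", OF binom_harm_0_Suc]
    nz_odd[OF order_refl] nz_shifted bsum_shift_theta_binom_harm_0
  unfolding theta_zero bsum_shift_zero bsum_shift_binom_harm_0[OF order_refl] bsum_binom_harm_0[OF order_refl]
  by (simp add: divide_simps) algebra

lemma bsum_shift_theta_binom_harm_1:
  "n \<ge> 2 \<Longrightarrow> bsum n (shift (theta (binom_harm x 1)))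
     = of_nat n * (of_nat n - 1) * central_gchoose x n / (x + of_nat n + 2) / (x + 2 * of_nat n + 1)
       * ((x + 1) * (harm_gap x n - 1 / (x + of_nat n + 2) - 1 / (x + 2 * of_nat n + 1)) + 1)"
  using bsum_theta_rec_solved[of n "binom_harm x 1" "x + 1", OF binom_harm_1_rec]
    bsum_theta_rec[of n "binom_harm x 1" "x + 1", OF binom_harm_1_rec]
    nz_odd[OF order_refl] nz_shifted bsum_shift_theta_binom_harm_0
  unfolding bsum_shift_binom_harm_0[OF order_refl] bsum_shift_binom_harm_1[OF order_refl]
    bsum_binom_harm_1[OF order_refl]
  by (simp add: divide_simps del: One_nat_def) algebra

lemma bsum_shift_theta_theta_binom_harm_1:
  assumes "n \<ge> 2"
  shows "bsum n (shift (theta (theta (binom_harm x 1))))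
     = of_nat n * (of_nat n - 1) * central_gchoose x n
       / (x + of_nat n + 2) / (x + of_nat n + 3) / (x + 2 * of_nat n + 1)
       * ((x + 1) * ((x + 3) * of_nat n - x - 1)
            * (harm_gap x n - 1 / (x + of_nat n + 2) - 1 / (x + of_nat n + 3) - 1 / (x + 2 * of_nat n + 1))
          + (2 * x + 4) * of_nat n - 2 * x - 2)"
proof -
  note nz = nz_odd[OF order_refl] nz_shifted[OF assms]
  have "bsum n (shift (theta (theta (binom_harm x 1)))) = bsum n (theta (theta (binom_harm x 1)))
      - (x + 2) * bsum n (shift (theta (binom_harm x 1))) - (x + 1) * bsum n (shift (binom_harm x 1))
      - bsum n (shift (binom_harm x 0)) - bsum n (shift (theta (binom_harm x 0)))"
    using bsum_theta_theta_rec[of n "binom_harm x 1" "x + 1", OF binom_harm_1_rec] by algebra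
  also note shift_theta_theta_elim[OF nz(1) nz(2) nz(3) _ _ _
    bsum_shift_binom_harm_0[OF order_refl] bsum_shift_binom_harm_1[OF order_refl]
    bsum_shift_theta_binom_harm_0[OF assms] bsum_shift_theta_binom_harm_1[OF assms]
    bsum_shift_theta_theta_binom_harm_0[OF assms]]
  finally show ?thesis
    using bsum_theta_theta_rec_solved[of n "binom_harm x 1" "x + 1", OF binom_harm_1_rec] by (simp add: add_ac)
qed

lemma bsum_theta_theta_binom_harm_2:
  assumes "n \<ge> 2"
  shows "bsum n (theta (theta (binom_harm x 2)))
    = central_gchoose x n / (x + of_nat n + 2) / (x + of_nat n + 3) *
      (of_nat n * ((x + 1) * (x * of_nat n + 3 * of_nat n + 1)
          * (harm_quad x n - 2 * (1 / (x + of_nat n + 2) + 1 / (x + of_nat n + 3)) * harm_gap x n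
             + (1 / (x + of_nat n + 2) + 1 / (x + of_nat n + 3))\<^sup>2
             + (1 / (x + of_nat n + 2))\<^sup>2 + (1 / (x + of_nat n + 3))\<^sup>2)
        - 2 * (1 / (x + of_nat n + 2) + 1 / (x + of_nat n + 3) - harm_gap x n)
          * (2 * x * of_nat n + 4 * of_nat n + 1))
      - alt_harm x n * (x + of_nat n + 1) * (x\<^sup>2 + 3 * x - 2 * of_nat n + 1)
      + (x\<^sup>2 + 3 * x + 3 * of_nat n ^ 2 - of_nat n + 1))"
proof (rule theta_theta_elim[OF nz_odd[OF order_refl] nz_shifted[OF assms] _ _ _
      bsum_shift_binom_harm_0[OF order_refl] bsum_shift_binom_harm_1[OF order_refl]
      bsum_shift_theta_binom_harm_0[OF assms] bsum_shift_theta_binom_harm_1[OF assms]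
      bsum_shift_theta_theta_binom_harm_1[OF assms] bsum_shift_binom_quot[OF order_refl] refl refl refl])
  \<comment> \<open>The inhomogeneity for the squared harmonic numbers. Its shifted sums under up to
    two \<open>theta\<close> become combinations of known sums.\<close>
  let ?r = "\<lambda>k. 2 * binom_harm x 1 k + binom_quot x k"
  have r: "bsum n (shift ?r) = 2 * bsum n (shift (binom_harm x 1)) + bsum n (shift (binom_quot x))"
    "bsum n (shift (theta ?r)) = 2 * bsum n (shift (theta (binom_harm x 1)))
       + (bsum n (shift (binom_harm x 0)) - (x + 1) * bsum n (shift (binom_quot x)))"
    "bsum n (shift (theta (theta ?r))) = 2 * bsum n (shift (theta (theta (binom_harm x 1))))
       + (bsum n (shift (theta (binom_harm x 0)))
          - (x + 1) * (bsum n (shift (binom_harm x 0)) - (x + 1) * bsum n (shift (binom_quot x))))"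
    by (simp_all only: theta_linear shift_linear bsum_linear bsum_shift_theta_binom_quot[OF order_refl]
        bsum_shift_theta_theta_binom_quot[OF order_refl])
  show "(x + of_nat n + 2) * bsum n (theta (binom_harm x 2))
      = (x + 1) * of_nat n * (central_gchoose x n * harm_quad x n)
        + 2 * of_nat n * (2 * bsum n (shift (binom_harm x 1)) + bsum n (shift (binom_quot x)))
        - (2 * bsum n (shift (theta (binom_harm x 1)))
           + (bsum n (shift (binom_harm x 0)) - (x + 1) * bsum n (shift (binom_quot x))))"
    using bsum_theta_rec_solved[of n "binom_harm x 2" "x + 1", OF binom_harm_2_rec]
    unfolding r bsum_binom_harm_2[OF order_refl] by algebra
  show "(x + 2 * of_nat n + 1) * bsum n (shift (binom_harm x 2))
      = of_nat n * (central_gchoose x n * harm_quad x n)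
        - (2 * bsum n (shift (binom_harm x 1)) + bsum n (shift (binom_quot x)))"
    using bsum_shift_rec[of n "binom_harm x 2" "x + 1", OF binom_harm_2_rec]
    unfolding r bsum_binom_harm_2[OF order_refl] by algebra
  show "bsum n (theta (binom_harm x 2)) = bsum n (shift (theta (binom_harm x 2)))
      + (x + 1) * bsum n (shift (binom_harm x 2))
      + (2 * bsum n (shift (binom_harm x 1)) + bsum n (shift (binom_quot x)))"
    using bsum_theta_rec[of n "binom_harm x 2" "x + 1", OF binom_harm_2_rec] unfolding r .
qed (use bsum_theta_theta_rec_solved[of n "binom_harm x 2" "x + 1", OF binom_harm_2_rec] in
    \<open>simp_all add: add_ac theta_linear shift_linear bsum_linear bsum_shift_theta_binom_quot
        bsum_shift_theta_theta_binom_quot del: One_nat_def\<close>)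

end

section \<open>Passage to the stated form\<close>

text \<open>Lowering the bottom index twice produces the factors x+n+2 and x+n+3, which cancel the
  denominators of \<open>bsum_theta_theta_binom_harm_2\<close>.\<close>

lemma gchoose_central_minus_2:
  assumes "n \<ge> 2"
  shows "of_nat n * (of_nat n - 1) * central_gchoose x n
    = (x + of_nat n + 2) * (x + of_nat n + 3) * ((x + 2 * of_nat n + 1) gchoose (n - 2))"
proof -
  let ?y = "x + 2 * of_nat n + 1"
  obtain m where n: "n = Suc (Suc m)"
    using assms by (metis Suc_le_D numeral_2_eq_2 Suc_le_mono)
  have "of_nat (Suc k) * (?y gchoose Suc k) = (?y - of_nat k) * (?y gchoose k)" for k
    using gbinomial_mult_1[of ?y k] by (simp add: algebra_simps)
  from this[of m] this[of "Suc m"] show ?thesis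
    unfolding n central_gchoose_def by simp algebra
qed

theorem theorem9:
  fixes x :: complex and n :: nat
  assumes "n \<ge> 2"
    and "\<forall>k\<in>{1..2*n+1}. x + of_nat k \<noteq> 0"
    and "x * of_nat n + 3 * of_nat n + 1 \<noteq> 0"
  shows "(\<Sum>k=0..n. ((2 * of_nat n - of_nat k) gchoose n) * ((x + of_nat k) gchoose k)
            * of_nat k ^ 2 * harm1 k x ^ 2)
    = (x + 1) * (x * of_nat n + 3 * of_nat n + 1) / (8 * (of_nat n - 1))
        * ((x + 2 * of_nat n + 1) gchoose (n - 2))
        * (8 * (harm1 (n+3) x - harm1 (2*n+1) x)
             * (harm1 (n+3) x - harm1 (2*n+1) x
                - 2 * (2 * x * of_nat n + 4 * of_nat n + 1)
                  / ((x + 1) * (x * of_nat n + 3 * of_nat n + 1)))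
           - (harm1 n (x/2) - harm1 (n+1) ((x-1)/2))
             * (harm1 n (x/2) - harm1 (n+1) ((x-1)/2)
                - 4 * (x + of_nat n + 1) * (x^2 + 3 * x - 2 * of_nat n + 1)
                  / (of_nat n * (x + 1) * (x * of_nat n + 3 * of_nat n + 1)))
           + 8 * gen_harm 2 (n+3) x - 4 * gen_harm 2 (2*n+1) x
           + 8 * (x^2 + 3 * x + 3 * of_nat n ^ 2 - of_nat n + 1)
             / (of_nat n * (x + 1) * (x * of_nat n + 3 * of_nat n + 1)))"
proof -
  define N P Q Y W c D E G b where defs: "N = (of_nat n :: complex)" "P = x + N + 2" "Q = x + N + 3"
    "Y = x + 1" "W = x * N + 3 * N + 1"
    "c = central_gchoose x n" "D = harm_gap x n" "E = alt_harm x n" "G = gen_harm 2 (n + 1) x"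
    "b = (x + 2 * N + 1) gchoose (n - 2)"
  have nz: "x + of_nat k \<noteq> 0" if "k \<in> {1..2*n+1}" for k using assms(2) that by blast
  have N0: "N \<noteq> 0" "N - 1 \<noteq> 0"
    using assms(1) by (auto simp: defs)
  have nz': "P \<noteq> 0" "Q \<noteq> 0" "Y \<noteq> 0" "W \<noteq> 0"
    using nz[of "n+2"] nz[of "n+3"] nz[of 1] assms(1,3) by (auto simp: defs add_ac)
  have A: "harm1 (n+3) x - harm1 (2*n+1) x = 1 / P + 1 / Q - D"
    by (simp add: defs harm_gap_def gen_harm_Suc eval_nat_numeral add_ac)
  have B: "harm1 n (x/2) - harm1 (n+1) ((x-1)/2) = - 2 * E"
    by (simp add: defs alt_harm_def)
  have C: "gen_harm 2 (n+3) x = G + (1 / P)\<^sup>2 + (1 / Q)\<^sup>2"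
    by (simp add: defs gen_harm_Suc numeral_3_eq_3 add_ac power_divide)
  \<comment> \<open>The definition of \<open>harm_quad\<close> solved for its order-two term at
    2n+1, so that both sides share the same independent quantities.\<close>
  have F: "gen_harm 2 (2*n+1) x = 2 * (D\<^sup>2 - E\<^sup>2 / 2 + G - harm_quad x n)"
    by (simp add: defs harm_quad_def)
  have c: "c = P * Q * b / (N * (N - 1))"
    using gchoose_central_minus_2[OF assms(1), of x] N0
    by (simp add: defs field_simps)
  have "(2 * of_nat n - of_nat k) gchoose n = of_nat ((2 * n - k) choose n)" if "k \<le> n" for k
    using that by (simp add: binomial_gbinomial of_nat_diff)
  then have "(\<Sum>k=0..n. ((2 * of_nat n - of_nat k) gchoose n) * ((x + of_nat k) gchoose k)
            * of_nat k ^ 2 * harm1 k x ^ 2) = bsum n (theta (theta (binom_harm x 2)))"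
    unfolding bsum_def theta_def binom_harm_def atLeast0AtMost
    by (intro sum.cong) (auto simp: power2_eq_square)
  also have "\<dots> = c / P / Q *
   (N * (Y * W * (harm_quad x n - 2 * (1 / P + 1 / Q) * D + (1 / P + 1 / Q)\<^sup>2 + (1 / P)\<^sup>2 + (1 / Q)\<^sup>2)
      - 2 * (1 / P + 1 / Q - D) * (2 * x * N + 4 * N + 1))
    - E * (x + N + 1) * (x\<^sup>2 + 3 * x - 2 * N + 1) + (x\<^sup>2 + 3 * x + 3 * N ^ 2 - N + 1))"
    using bsum_theta_theta_binom_harm_2[OF nz assms(1)] unfolding defs by simp
  \<comment> \<open>On the right E^2 and G cancel, and D^2 cancels against the square of 1/P + 1/Q -
    D, which leaves \<open>harm_quad\<close> linearly as on the left.\<close>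
  also have "\<dots> = Y * W / (8 * (N - 1)) * b
     * (8 * (1 / P + 1 / Q - D) * ((1 / P + 1 / Q - D) - 2 * (2 * x * N + 4 * N + 1) / (Y * W))
        - (- 2 * E) * (- 2 * E - 4 * (x + N + 1) * (x\<^sup>2 + 3 * x - 2 * N + 1) / (N * Y * W))
        + 8 * (G + (1 / P)\<^sup>2 + (1 / Q)\<^sup>2) - 4 * (2 * (D\<^sup>2 - E\<^sup>2 / 2 + G - harm_quad x n))
        + 8 * (x\<^sup>2 + 3 * x + 3 * N ^ 2 - N + 1) / (N * Y * W))"
    unfolding c using N0 nz' by (simp add: divide_simps) algebra
  finally show ?thesis
    unfolding A B C F unfolding defs .
qed

end
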